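(* The hyperbolic Heisenberg group $\mathfrak H^\star$ is isomorphic to $AN\times\mathrm U(1)$, where $AN$ is the product of the $A$ and $N$ factors in the Iwasawa decomposition $KAN$ of $\mathrm{SU}(1,1)$.
   Context: The hyperbolic Heisenberg group $\mathfrak H^\star$ is the Lie group $\mathbb C_*\times\mathbb R$, $\mathbb C_*=\mathbb C\setminus\{0\}$, with product $(z,t)\star(w,s)=(zw,\,t+s|z|^2)$. $\mathrm{SU}(1,1)$ is realized as $$\mathrm{SU}(1,1)=\left\{\begin{pmatrix}a&ib\\ ic&d\end{pmatrix}:\ a,b,c,d\in\mathbb R,\ ad+bc=1\right\}.$$ In its Iwasawa decomposition $KAN$, $K=\left\{\begin{pmatrix}\cos\theta&i\sin\theta\\ i\sin\theta&\cos\theta\end{pmatrix}:\theta\in\mathbb R\right\}$, $A=\left\{\begin{pmatrix}r&0\\0&1/r\end{pmatrix}:r>0\right\}$, $N=\left\{\begin{pmatrix}1&it\\0&1\end{pmatrix}:t\in\mathbb R\right\}$, and $AN$ is the subgroup of all products of an element of $A$ with an element of $N$. *)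

theory Defs
  imports "HOL-Analysis.Analysis" "HOL-Algebra.Coset"
begin

text \<open>
  All Lie groups below are embedded submanifolds of Euclidean spaces: an open subset of
  \<open>complex \<times> real\<close>, matrix groups closed in \<open>GL(2,\<complex>)\<close>, the unit circle, and products of such.
  For embedded submanifolds, intrinsic smoothness of a map coincides with the existence of local
  smooth extensions to the ambient space.
\<close>

primrec Ck_on ::
    "nat \<Rightarrow> 'a::euclidean_space set \<Rightarrow> ('a \<Rightarrow> 'b::euclidean_space) \<Rightarrow> bool" where
  "Ck_on 0 U f \<longleftrightarrow> continuous_on U f"
| "Ck_on (Suc k) U f \<longleftrightarrow>
     (\<forall>x\<in>U. f differentiable (at x)) \<and>
     (\<forall>v. Ck_on k U (\<lambda>x. frechet_derivative f (at x) v))"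

text \<open>The following is the usual notion only for open \<open>U\<close>.\<close>

definition smooth_on_open ::
    "'a::euclidean_space set \<Rightarrow> ('a \<Rightarrow> 'b::euclidean_space) \<Rightarrow> bool" where
  "smooth_on_open U f \<longleftrightarrow> (\<forall>k. Ck_on k U f)"

definition smooth_map_on ::
    "'a::euclidean_space set \<Rightarrow> ('a \<Rightarrow> 'b::euclidean_space) \<Rightarrow> bool" where
  "smooth_map_on S f \<longleftrightarrow>
     (\<forall>x\<in>S. \<exists>U g. open U \<and> x \<in> U \<and> smooth_on_open U g \<and> (\<forall>y\<in>S \<inter> U. g y = f y))"

definition lie_group_iso ::
    "('a::euclidean_space, 'm) monoid_scheme \<Rightarrow> ('b::euclidean_space, 'n) monoid_scheme
      \<Rightarrow> ('a \<Rightarrow> 'b) set" where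
  "lie_group_iso G H =
     {\<phi> \<in> iso G H. smooth_map_on (carrier G) \<phi> \<and>
        smooth_map_on (carrier H) (inv_into (carrier G) \<phi>)}"

definition lie_group_isomorphic ::
    "('a::euclidean_space, 'm) monoid_scheme \<Rightarrow> ('b::euclidean_space, 'n) monoid_scheme \<Rightarrow> bool" where
  "lie_group_isomorphic G H \<longleftrightarrow> lie_group_iso G H \<noteq> {}"

definition hyp_heisenberg :: "(complex \<times> real) monoid" where
  "hyp_heisenberg =
     \<lparr>carrier = (UNIV - {0}) \<times> UNIV,
      mult = (\<lambda>(z, t) (w, s). (z * w, t + s * (cmod z)\<^sup>2)),
      one = (1, 0)\<rparr>"

definition mat2 :: "complex \<Rightarrow> complex \<Rightarrow> complex \<Rightarrow> complex \<Rightarrow> complex^2^2" where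
  "mat2 p q r s = vector [vector [p, q], vector [r, s]]"

definition SU11 :: "(complex^2^2) monoid" where
  "SU11 =
     \<lparr>carrier = {mat2 (of_real a) (\<i> * of_real b) (\<i> * of_real c) (of_real d) | a b c d :: real.
                   a * d + b * c = 1},
      mult = (**),
      one = mat 1\<rparr>"

definition Iwasawa_A :: "(complex^2^2) set" where
  "Iwasawa_A = {mat2 (of_real r) 0 0 (of_real (1 / r)) | r :: real. r > 0}"

definition Iwasawa_N :: "(complex^2^2) set" where
  "Iwasawa_N = {mat2 1 (\<i> * of_real t) 0 1 | t :: real. True}"

definition Iwasawa_AN :: "(complex^2^2) monoid" where
  "Iwasawa_AN = SU11\<lparr>carrier := Iwasawa_A <#>\<^bsub>SU11\<^esub> Iwasawa_N\<rparr>"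

definition U1 :: "complex monoid" where
  "U1 = \<lparr>carrier = sphere 0 1, mult = (*), one = 1\<rparr>"

lemma mat2_eq_iff: "mat2 p q r s = mat2 p' q' r' s' \<longleftrightarrow> p = p' \<and> q = q' \<and> r = r' \<and> s = s'"
  by (auto simp: mat2_def vec_eq_iff forall_2)

lemma mat2_mult:
  "mat2 p q r s ** mat2 p' q' r' s' =
     mat2 (p * p' + q * r') (p * q' + q * s') (r * p' + s * r') (r * q' + s * s')"
  by (simp add: mat2_def vec_eq_iff forall_2 matrix_matrix_mult_def sum_2)

lemma mat2_one: "mat 1 = mat2 1 0 0 1"
  by (simp add: mat2_def vec_eq_iff forall_2 mat_def)

lemma group_hyp_heisenberg: "group hyp_heisenberg"
proof (rule groupI)
  fix x assume "x \<in> carrier hyp_heisenberg"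
  then obtain z t where x: "x = (z, t)" "z \<noteq> 0"
    by (auto simp: hyp_heisenberg_def)
  have "(inverse z, - t / (cmod z)\<^sup>2) \<otimes>\<^bsub>hyp_heisenberg\<^esub> x = \<one>\<^bsub>hyp_heisenberg\<^esub>"
    using x by (simp add: hyp_heisenberg_def norm_inverse power_inverse divide_inverse)
  moreover have "(inverse z, - t / (cmod z)\<^sup>2) \<in> carrier hyp_heisenberg"
    using x by (simp add: hyp_heisenberg_def)
  ultimately show "\<exists>y\<in>carrier hyp_heisenberg. y \<otimes>\<^bsub>hyp_heisenberg\<^esub> x = \<one>\<^bsub>hyp_heisenberg\<^esub>"
    by blast
qed (auto simp: hyp_heisenberg_def norm_mult power_mult_distrib algebra_simps)

lemma SU11_memI:
  "a * d + b * c = 1 \<Longrightarrow>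
     mat2 (of_real a) (\<i> * of_real b) (\<i> * of_real c) (of_real d) \<in> carrier SU11"
  by (auto simp: SU11_def)

lemma SU11_mult:
  "mat2 (of_real a) (\<i> * of_real b) (\<i> * of_real c) (of_real d) ** 
   mat2 (of_real a') (\<i> * of_real b') (\<i> * of_real c') (of_real d') =
   mat2 (of_real (a * a' - b * c')) (\<i> * of_real (a * b' + b * d'))
        (\<i> * of_real (c * a' + d * c')) (of_real (d * d' - c * b'))"
  by (simp add: mat2_mult mat2_eq_iff algebra_simps)

lemma group_SU11: "group SU11"
proof (rule groupI)
  fix x y assume "x \<in> carrier SU11" "y \<in> carrier SU11"
  then obtain a b c d a' b' c' d' where
    xy: "x = mat2 (of_real a) (\<i> * of_real b) (\<i> * of_real c) (of_real d)"
        "y = mat2 (of_real a') (\<i> * of_real b') (\<i> * of_real c') (of_real d')"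
    and det: "a * d + b * c = 1" "a' * d' + b' * c' = 1"
    by (auto simp: SU11_def)
  have "(a * a' - b * c') * (d * d' - c * b') + (a * b' + b * d') * (c * a' + d * c') =
        (a * d + b * c) * (a' * d' + b' * c')"
    by algebra
  then have "x ** y \<in> carrier SU11"
    unfolding xy SU11_mult by (intro SU11_memI) (simp add: det)
  then show "x \<otimes>\<^bsub>SU11\<^esub> y \<in> carrier SU11"
    by (simp add: SU11_def)
next
  show "\<one>\<^bsub>SU11\<^esub> \<in> carrier SU11"
    using SU11_memI[of 1 1 0 0] by (simp add: SU11_def mat2_one)
next
  fix x assume "x \<in> carrier SU11"
  then obtain a b c d where
    x: "x = mat2 (of_real a) (\<i> * of_real b) (\<i> * of_real c) (of_real d)" "a * d + b * c = 1"
    by (auto simp: SU11_def)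
  let ?y = "mat2 (of_real d) (\<i> * of_real (-b)) (\<i> * of_real (-c)) (of_real a)"
  have "d * a - - b * c = 1" "a * d - - c * b = 1" "d * b + - b * d = 0" "- c * a + a * c = 0"
    using x(2) by (simp_all add: algebra_simps)
  then have "?y ** x = mat 1"
    unfolding x(1) SU11_mult mat2_one mat2_eq_iff by (simp del: of_real_add of_real_diff of_real_mult)
  moreover have "?y \<in> carrier SU11"
    using x(2) by (intro SU11_memI) (simp add: algebra_simps)
  ultimately show "\<exists>y\<in>carrier SU11. y \<otimes>\<^bsub>SU11\<^esub> x = \<one>\<^bsub>SU11\<^esub>"
    by (intro bexI[of _ ?y]) (simp_all add: SU11_def)
qed (auto simp: SU11_def matrix_mul_assoc)

lemma carrier_Iwasawa_AN:
  "carrier Iwasawa_AN =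
     {mat2 (of_real r) (\<i> * of_real b) 0 (of_real (1 / r)) | r b :: real. r > 0}" (is "_ = ?R")
proof
  show "carrier Iwasawa_AN \<subseteq> ?R"
  proof
    fix x assume "x \<in> carrier Iwasawa_AN"
    then obtain r t where "r > 0"
      "x = mat2 (of_real r) 0 0 (of_real (1 / r)) ** mat2 1 (\<i> * of_real t) 0 1"
      by (auto simp: Iwasawa_AN_def set_mult_def SU11_def Iwasawa_A_def Iwasawa_N_def)
    then have "x = mat2 (of_real r) (\<i> * of_real (r * t)) 0 (of_real (1 / r))"
      by (simp add: mat2_mult algebra_simps)
    with \<open>r > 0\<close> show "x \<in> ?R" by blast
  qed
  show "?R \<subseteq> carrier Iwasawa_AN"
  proof
    fix x assume "x \<in> ?R"
    then obtain r b where r: "r > 0" "x = mat2 (of_real r) (\<i> * of_real b) 0 (of_real (1 / r))"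
      by auto
    then have "x = mat2 (of_real r) 0 0 (of_real (1 / r)) ** mat2 1 (\<i> * of_real (b / r)) 0 1"
      by (simp add: mat2_mult mat2_eq_iff)
    moreover have "mat2 (of_real r) 0 0 (of_real (1 / r)) \<in> Iwasawa_A"
      using r(1) unfolding Iwasawa_A_def by blast
    moreover have "mat2 1 (\<i> * of_real (b / r)) 0 1 \<in> Iwasawa_N"
      unfolding Iwasawa_N_def by blast
    ultimately show "x \<in> carrier Iwasawa_AN"
      by (auto simp: Iwasawa_AN_def set_mult_def SU11_def)
  qed
qed

lemma subgroup_AN: "subgroup (carrier Iwasawa_AN) SU11"
proof (rule group.subgroupI[OF group_SU11])
  interpret group SU11 by (rule group_SU11)
  show sub: "carrier Iwasawa_AN \<subseteq> carrier SU11"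
  proof
    fix x assume "x \<in> carrier Iwasawa_AN"
    then obtain r b where "r > 0" "x = mat2 (of_real r) (\<i> * of_real b) 0 (of_real (1 / r))"
      by (auto simp: carrier_Iwasawa_AN)
    then show "x \<in> carrier SU11" using SU11_memI[of r "1 / r" b 0] by simp
  qed
  have "mat2 (of_real 1) (\<i> * of_real 0) 0 (of_real (1 / 1)) \<in> carrier Iwasawa_AN"
    unfolding carrier_Iwasawa_AN using zero_less_one by blast
  then show "carrier Iwasawa_AN \<noteq> {}" by blast
  fix x assume x: "x \<in> carrier Iwasawa_AN"
  then obtain r b where r: "r > 0" "x = mat2 (of_real r) (\<i> * of_real b) 0 (of_real (1 / r))"
    by (auto simp: carrier_Iwasawa_AN)
  let ?y = "mat2 (of_real (1 / r)) (\<i> * of_real (- b)) 0 (of_real (1 / (1 / r)))"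
  have y: "?y \<in> carrier Iwasawa_AN"
    unfolding carrier_Iwasawa_AN using r(1) zero_less_divide_1_iff by blast
  have "?y ** x = mat 1"
    using r by (simp add: mat2_mult mat2_one mat2_eq_iff)
  then have "inv\<^bsub>SU11\<^esub> x = ?y"
    using x y sub by (intro inv_equality) (auto simp: SU11_def)
  with y show "inv\<^bsub>SU11\<^esub> x \<in> carrier Iwasawa_AN" by simp
  fix x' assume "x' \<in> carrier Iwasawa_AN"
  then obtain r' b' where r': "r' > 0" "x' = mat2 (of_real r') (\<i> * of_real b') 0 (of_real (1 / r'))"
    by (auto simp: carrier_Iwasawa_AN)
  have "x ** x' = mat2 (of_real (r * r')) (\<i> * of_real (r * b' + b / r')) 0 (of_real (1 / (r * r')))"
    using r r' by (simp add: mat2_mult mat2_eq_iff algebra_simps)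
  moreover have "r * r' > 0" using r(1) r'(1) by simp
  ultimately have "x ** x' \<in> carrier Iwasawa_AN"
    unfolding carrier_Iwasawa_AN by blast
  then show "x \<otimes>\<^bsub>SU11\<^esub> x' \<in> carrier Iwasawa_AN" by (simp add: SU11_def)
qed

lemma group_AN: "group Iwasawa_AN"
  using group.subgroup_imp_group[OF group_SU11 subgroup_AN] by (simp add: Iwasawa_AN_def)

lemma group_U1: "group U1"
proof (rule groupI)
  fix x assume "x \<in> carrier U1"
  then show "\<exists>y\<in>carrier U1. y \<otimes>\<^bsub>U1\<^esub> x = \<one>\<^bsub>U1\<^esub>"
    by (intro bexI[of _ "inverse x"]) (auto simp: U1_def norm_inverse intro!: left_inverse)
qed (auto simp: U1_def norm_mult)

end

(* Rescaling the Heisenberg coordinate t to t / |z| turns the twisted addition t + s |z|^2 into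
   the product of the upper triangular matrices [[|z|, i t / |z|], [0, 1 / |z|]] of AN, and the
   phase z / |z| splits off as the factor U(1).  All entries are polynomial in the linear
   coordinates and h = 1 / |z|.  Since the derivative of h is itself such a polynomial,
   smoothness follows by bootstrapping from bilinear operations alone. *)

theory Submission
  imports Defs
begin

lemma Ck_on_cong:
  assumes "open U" "\<And>x. x \<in> U \<Longrightarrow> f x = g x"
  shows "Ck_on k U f \<longleftrightarrow> Ck_on k U g"
  using assms(2)
proof (induction k arbitrary: f g)
  case 0
  then show ?case by (simp cong: continuous_on_cong)
next
  case (Suc k)
  have D: "(f has_derivative F) (at x) \<longleftrightarrow> (g has_derivative F) (at x)" if "x \<in> U" for x F
    using has_derivative_transform_within_open[OF _ assms(1) that, of f F UNIV g]
      has_derivative_transform_within_open[OF _ assms(1) that, of g F UNIV f] Suc.prems by auto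
  then have "frechet_derivative f (at x) = frechet_derivative g (at x)" if "x \<in> U" for x
    using that by (simp add: frechet_derivative_def)
  then have "Ck_on k U (\<lambda>x. frechet_derivative f (at x) v) \<longleftrightarrow>
      Ck_on k U (\<lambda>x. frechet_derivative g (at x) v)" for v
    by (intro Suc.IH) simp
  then show ?case using D by (simp add: differentiable_def)
qed

lemma Ck_on_SucI:
  assumes "open U" "\<And>x. x \<in> U \<Longrightarrow> (f has_derivative f' x) (at x)"
    and "\<And>v. Ck_on k U (\<lambda>x. f' x v)"
  shows "Ck_on (Suc k) U f"
proof -
  have "frechet_derivative f (at x) = f' x" if "x \<in> U" for x
    using frechet_derivative_at[OF assms(2)[OF that]] by simp
  then have "Ck_on k U (\<lambda>x. frechet_derivative f (at x) v)" for v
    using Ck_on_cong[OF assms(1), of "\<lambda>x. frechet_derivative f (at x) v" "\<lambda>x. f' x v"] assms(3)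
    by simp
  then show ?thesis using assms(2) by (auto simp: differentiable_def)
qed

lemma Ck_on_SucD:
  assumes "Ck_on (Suc k) U f"
  shows "Ck_on k U f"
  using assms
proof (induction k arbitrary: f)
  case 0
  then show ?case
    by (auto intro!: continuous_at_imp_continuous_on differentiable_imp_continuous_within)
next
  case (Suc k)
  then show ?case by (metis Ck_on.simps(2))
qed

lemma Ck_on_derivative:
  assumes "Ck_on (Suc k) U f"
  shows "x \<in> U \<Longrightarrow> (f has_derivative frechet_derivative f (at x)) (at x)"
    and "Ck_on k U (\<lambda>x. frechet_derivative f (at x) v)"
  using assms by (auto simp: frechet_derivative_works)

lemma Ck_on_const:
  assumes "open U"
  shows "Ck_on k U (\<lambda>_. c)"
proof (induction k arbitrary: c)
  case (Suc k)
  then show ?case by (intro Ck_on_SucI[where f' = "\<lambda>_ _. 0"] assms) auto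
qed simp

lemma Ck_on_add:
  assumes "open U" "Ck_on k U f" "Ck_on k U g"
  shows "Ck_on k U (\<lambda>x. f x + g x)"
  using assms(2,3)
proof (induction k arbitrary: f g)
  case (Suc k)
  show ?case
    by (rule Ck_on_SucI[OF assms(1) has_derivative_add[OF
          Ck_on_derivative(1)[OF Suc.prems(1)] Ck_on_derivative(1)[OF Suc.prems(2)]]])
      (auto intro!: Suc.IH Ck_on_derivative(2) Suc.prems simp del: Ck_on.simps)
qed (simp add: continuous_on_add)

lemma Ck_on_bounded_linear:
  assumes "bounded_linear L" "open U" "Ck_on k U g"
  shows "Ck_on k U (\<lambda>x. L (g x))"
  using assms(3)
proof (induction k arbitrary: g)
  case 0
  then show ?case using bounded_linear.continuous_on[OF assms(1)] by simp
next
  case (Suc k)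
  show ?case
    by (rule Ck_on_SucI[OF assms(2) bounded_linear.has_derivative[OF assms(1)
          Ck_on_derivative(1)[OF Suc.prems]]])
      (auto intro!: Suc.IH Ck_on_derivative(2) Suc.prems simp del: Ck_on.simps)
qed

lemma Ck_on_bounded_bilinear:
  assumes "bounded_bilinear B" "open U" "Ck_on k U f" "Ck_on k U g"
  shows "Ck_on k U (\<lambda>x. B (f x) (g x))"
  using assms(3,4)
proof (induction k arbitrary: f g)
  case 0
  then show ?case using bounded_bilinear.continuous_on[OF assms(1)] by simp
next
  case (Suc k)
  show ?case
    by (rule Ck_on_SucI[OF assms(2) bounded_bilinear.FDERIV[OF assms(1)
          Ck_on_derivative(1)[OF Suc.prems(1)] Ck_on_derivative(1)[OF Suc.prems(2)]]])
      (auto intro!: Ck_on_add[OF assms(2)] Suc.IH Ck_on_derivative(2) Suc.prems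
          Ck_on_SucD[OF Suc.prems(1)] Ck_on_SucD[OF Suc.prems(2)]
        simp del: Ck_on.simps)
qed

lemma Ck_on_id:
  assumes "open U"
  shows "Ck_on k U (\<lambda>x. x)"
proof (cases k)
  case (Suc j)
  then show ?thesis
    by (auto intro!: Ck_on_SucI[where f' = "\<lambda>_ v. v"] Ck_on_const assms simp del: Ck_on.simps)
qed simp

lemma bounded_linear_Ck_on: "bounded_linear f \<Longrightarrow> open U \<Longrightarrow> Ck_on k U f"
  using Ck_on_bounded_linear[OF _ _ Ck_on_id] by auto

lemma Ck_on_Pair:
  fixes f :: "'a::euclidean_space \<Rightarrow> 'b::euclidean_space"
    and g :: "'a \<Rightarrow> 'c::euclidean_space"
  assumes "open U" "Ck_on k U f" "Ck_on k U g"
  shows "Ck_on k U (\<lambda>x. (f x, g x))"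
proof -
  have "bounded_linear (\<lambda>y::'b. (y, 0::'c))" "bounded_linear (\<lambda>y::'c. (0::'b, y))"
    by (intro bounded_linear_Pair bounded_linear_ident bounded_linear_zero)+
  then have "Ck_on k U (\<lambda>x. (f x, 0) + (0, g x))"
    using assms by (intro Ck_on_add) (auto intro: Ck_on_bounded_linear)
  then show ?thesis by simp
qed

lemma Ck_on_inverse_norm:
  fixes p :: "'a::euclidean_space \<Rightarrow> 'b::euclidean_space"
  assumes "open U" "bounded_linear p" "\<And>x. x \<in> U \<Longrightarrow> p x \<noteq> 0"
  shows "Ck_on k U (\<lambda>x. inverse (norm (p x)))"
proof (induction k)
  case 0
  have "continuous_on U p" using assms(2) by (rule linear_continuous_on)
  then show ?case using assms(3) by (auto intro!: continuous_intros)
next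
  case (Suc k)
  let ?h = "\<lambda>x. inverse (norm (p x))"
  have "(?h has_derivative (\<lambda>v. - (?h x * (?h x * (?h x * (p x \<bullet> p v)))))) (at x)"
    if x: "x \<in> U" for x
  proof -
    have "(p has_derivative p) (at x)"
      using assms(2) by (rule bounded_linear_imp_has_derivative)
    from Deriv.has_derivative_inverse[OF _ has_derivative_compose[OF this has_derivative_norm[OF assms(3)[OF x]]]]
    show ?thesis
      using assms(3)[OF x] by (simp add: sgn_div_norm inner_commute mult_ac)
  qed
  moreover have "Ck_on k U (\<lambda>x. - (?h x * (?h x * (?h x * (p x \<bullet> p v)))))" for v
    using bounded_linear_Ck_on[OF assms(2,1)] Suc assms(1)
    by (intro Ck_on_bounded_linear[OF bounded_linear_minus[OF bounded_linear_ident]]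
        Ck_on_bounded_bilinear[OF bounded_bilinear_mult]
        Ck_on_bounded_bilinear[OF bounded_bilinear_inner] Ck_on_const) auto
  ultimately show ?case by (rule Ck_on_SucI[OF assms(1)])
qed

lemma smooth_map_onI:
  assumes "open U" "S \<subseteq> U" "\<And>k. Ck_on k U g" "\<And>x. x \<in> S \<Longrightarrow> f x = g x"
  shows "smooth_map_on S f"
  unfolding smooth_map_on_def smooth_on_open_def
  using assms by (intro ballI exI[of _ U] exI[of _ g]) auto

definition heis_to_AN_U1 :: "complex \<times> real \<Rightarrow> (complex^2^2) \<times> complex" where
  "heis_to_AN_U1 = (\<lambda>(z, t).
     (mat2 (of_real (cmod z)) (\<i> * of_real (t / cmod z)) 0 (of_real (1 / cmod z)), sgn z))"

definition AN_U1_to_heis :: "(complex^2^2) \<times> complex \<Rightarrow> complex \<times> real" where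
  "AN_U1_to_heis = (\<lambda>(m, u). (Re (m $ 1 $ 1) *\<^sub>R u, Im (m $ 1 $ 2) * Re (m $ 1 $ 1)))"

lemma mat2_nth [simp]: "mat2 p q r s $ 1 $ 1 = p" "mat2 p q r s $ 1 $ 2 = q"
  by (simp_all add: mat2_def)

lemma AN_U1_to_heis_to_AN_U1:
  assumes "x \<in> carrier hyp_heisenberg"
  shows "AN_U1_to_heis (heis_to_AN_U1 x) = x"
  using assms
  by (auto simp: hyp_heisenberg_def heis_to_AN_U1_def AN_U1_to_heis_def sgn_div_norm)

lemma heis_to_AN_U1_to_heis:
  assumes "y \<in> carrier (Iwasawa_AN \<times>\<times> U1)"
  shows "heis_to_AN_U1 (AN_U1_to_heis y) = y"
  using assms
  by (auto simp: DirProd_def carrier_Iwasawa_AN U1_def heis_to_AN_U1_def AN_U1_to_heis_def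
      mat2_eq_iff sgn_div_norm scaleR_conv_of_real norm_mult)

lemma heis_to_AN_U1_closed:
  assumes "x \<in> carrier hyp_heisenberg"
  shows "heis_to_AN_U1 x \<in> carrier (Iwasawa_AN \<times>\<times> U1)"
proof -
  obtain z t where x: "x = (z, t)" "z \<noteq> 0" using assms by (auto simp: hyp_heisenberg_def)
  then have "mat2 (of_real (cmod z)) (\<i> * of_real (t / cmod z)) 0 (of_real (1 / cmod z))
      \<in> carrier Iwasawa_AN"
    unfolding carrier_Iwasawa_AN using zero_less_norm_iff by blast
  with x show ?thesis by (simp add: heis_to_AN_U1_def DirProd_def U1_def norm_sgn)
qed

lemma AN_U1_to_heis_closed:
  assumes "y \<in> carrier (Iwasawa_AN \<times>\<times> U1)"
  shows "AN_U1_to_heis y \<in> carrier hyp_heisenberg"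
  using assms
  by (auto simp: DirProd_def carrier_Iwasawa_AN U1_def hyp_heisenberg_def AN_U1_to_heis_def)

lemma heis_to_AN_U1_mult:
  assumes "x \<in> carrier hyp_heisenberg" "y \<in> carrier hyp_heisenberg"
  shows "heis_to_AN_U1 (x \<otimes>\<^bsub>hyp_heisenberg\<^esub> y) =
    heis_to_AN_U1 x \<otimes>\<^bsub>Iwasawa_AN \<times>\<times> U1\<^esub> heis_to_AN_U1 y"
proof -
  obtain z t w s where xy: "x = (z, t)" "y = (w, s)" and nz: "z \<noteq> 0" "w \<noteq> 0"
    using assms by (auto simp: hyp_heisenberg_def)
  then show ?thesis
    by (simp add: hyp_heisenberg_def heis_to_AN_U1_def DirProd_def Iwasawa_AN_def SU11_def
        U1_def mat2_mult mat2_eq_iff norm_mult sgn_mult field_simps power2_eq_square)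
qed

lemma smooth_heis_to_AN_U1: "smooth_map_on (carrier hyp_heisenberg) heis_to_AN_U1"
proof (rule smooth_map_onI)
  let ?U = "(UNIV - {0}) \<times> UNIV :: (complex \<times> real) set"
  let ?h = "\<lambda>x::complex \<times> real. inverse (cmod (fst x))"
  let ?g = "\<lambda>x::complex \<times> real. ((?h x * (fst x \<bullet> fst x)) *\<^sub>R mat2 1 0 0 0
    + ((?h x * snd x) *\<^sub>R mat2 0 \<i> 0 0 + ?h x *\<^sub>R mat2 0 0 0 1), ?h x *\<^sub>R fst x)"
  show U: "open ?U" by (intro open_Times open_delete open_UNIV)
  show "carrier hyp_heisenberg \<subseteq> ?U" by (simp add: hyp_heisenberg_def)
  have h: "Ck_on k ?U ?h" for k
    using U by (intro Ck_on_inverse_norm bounded_linear_fst) auto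
  show "Ck_on k ?U ?g" for k
    using U h bounded_linear_Ck_on[OF bounded_linear_fst U]
      bounded_linear_Ck_on[OF bounded_linear_snd U]
    by (intro Ck_on_Pair Ck_on_add Ck_on_bounded_bilinear[OF bounded_bilinear_scaleR]
        Ck_on_bounded_bilinear[OF bounded_bilinear_mult]
        Ck_on_bounded_bilinear[OF bounded_bilinear_inner] Ck_on_const) auto
  show "heis_to_AN_U1 x = ?g x" if x: "x \<in> carrier hyp_heisenberg" for x
  proof -
    have "inverse (cmod (fst x)) * (fst x \<bullet> fst x) = cmod (fst x)"
      by (cases "fst x = 0") (simp_all add: dot_square_norm power2_eq_square)
    then show ?thesis
      by (cases x) (simp add: heis_to_AN_U1_def mat2_def vec_eq_iff forall_2 sgn_div_norm
          scaleR_conv_of_real[where 'a = complex] divide_inverse mult_ac)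
  qed
qed

lemma Ck_on_AN_U1_to_heis: "Ck_on k UNIV AN_U1_to_heis"
proof -
  have entry: "bounded_linear (\<lambda>x::(complex^2^2) \<times> complex. fst x $ i $ j)" for i j
    by (intro bounded_linear_compose[OF bounded_linear_vec_nth] bounded_linear_fst)
  have "Ck_on k UNIV (\<lambda>x::(complex^2^2) \<times> complex.
      (Re (fst x $ 1 $ 1) *\<^sub>R snd x, Im (fst x $ 1 $ 2) * Re (fst x $ 1 $ 1)))"
    by (intro Ck_on_Pair Ck_on_bounded_bilinear[OF bounded_bilinear_scaleR]
        Ck_on_bounded_bilinear[OF bounded_bilinear_mult] bounded_linear_Ck_on open_UNIV
        bounded_linear_compose[OF bounded_linear_Re] bounded_linear_compose[OF bounded_linear_Im]
        entry bounded_linear_snd)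
  then show ?thesis by (simp add: AN_U1_to_heis_def case_prod_beta')
qed

theorem mainTheorem4: "lie_group_isomorphic hyp_heisenberg (Iwasawa_AN \<times>\<times> U1)"
proof -
  let ?G = "carrier hyp_heisenberg" and ?H = "carrier (Iwasawa_AN \<times>\<times> U1)"
  have bij: "bij_betw heis_to_AN_U1 ?G ?H"
    by (rule bij_betwI[where g = AN_U1_to_heis]) (blast intro: heis_to_AN_U1_closed
        AN_U1_to_heis_closed AN_U1_to_heis_to_AN_U1 heis_to_AN_U1_to_heis)+
  have "heis_to_AN_U1 \<in> iso hyp_heisenberg (Iwasawa_AN \<times>\<times> U1)"
    by (intro isoI homI bij heis_to_AN_U1_closed heis_to_AN_U1_mult)
  moreover have "inv_into ?G heis_to_AN_U1 y = AN_U1_to_heis y" if "y \<in> ?H" for y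
    using that bij_betw_imp_inj_on[OF bij]
    by (intro inv_into_f_eq) (auto intro: AN_U1_to_heis_closed heis_to_AN_U1_to_heis)
  then have "smooth_map_on ?H (inv_into ?G heis_to_AN_U1)"
    by (intro smooth_map_onI[OF open_UNIV subset_UNIV Ck_on_AN_U1_to_heis]) auto
  ultimately show ?thesis
    using smooth_heis_to_AN_U1 by (auto simp: lie_group_isomorphic_def lie_group_iso_def)
qed

end
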